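(* Let $\mathtt{X}\in\{\mathtt{CT},\mathtt{T}\}$, with $\mathcal{E}_{\mathtt{CT}}=\mathcal{E}_1\cup\{\mathrm{CT},\mathrm{CTP},\mathrm{EL1}\}$ and $\mathcal{E}_{\mathtt{T}}=\mathcal{E}_1\cup\{\mathrm{T},\mathrm{TP},\mathrm{EL1}\}$. Then $\mathcal{E}_{\mathtt{X}}$ is a ground-complete axiomatisation of $\mathrm{BCCSP}_{\|}$ modulo $\sim_{\mathtt{X}}$: for all closed $\mathrm{BCCSP}_{\|}$ terms $p,q$, $p\sim_{\mathtt{X}} q$ if and only if $\mathcal{E}_{\mathtt{X}}\vdash p\approx q$.
   Context: Let $\mathcal{A}$ be a finite non-empty set of actions and $\mathcal{V}$ a countably infinite set of variables. $\mathrm{BCCSP}_{\|}$ terms: $t ::= \mathbf{0} \mid x \mid a.t \mid t+t \mid t \,\|\, t$ ($a\in\mathcal{A}$, $x\in\mathcal{V}$; $ax$ means $a.x$). Closed terms are processes. Transitions: $a.p \xrightarrow{a} p$; if $p \xrightarrow{a} p'$ then $p+q \xrightarrow{a} p'$, $q+p \xrightarrow{a} p'$, $p\|q \xrightarrow{a} p'\|q$, $q \| p \xrightarrow{a} q \| p'$. For $\alpha=a_1\cdots a_n\in\mathcal{A}^*$, $p\xrightarrow{\alpha}p'$ means $p=p_0\xrightarrow{a_1}\cdots\xrightarrow{a_n}p_n=p'$. $\mathtt{T}(p)=\{\alpha\mid \exists p'.\,p\xrightarrow{\alpha}p'\}$ (traces) and $\mathtt{CT}(p)=\{\alpha\mid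 p\xrightarrow{\alpha}p',\ p' \text{ has no outgoing transition}\}$ (completed traces). $p\sim_{\mathtt{T}}q$ iff $\mathtt{T}(p)=\mathtt{T}(q)$; $p\sim_{\mathtt{CT}}q$ iff $\mathtt{T}(p)=\mathtt{T}(q)$ and $\mathtt{CT}(p)=\mathtt{CT}(q)$. $\mathcal{E}\vdash t\approx u$: derivable in equational logic (reflexivity, symmetry, transitivity, substitution instances of axioms, closure under $a.\_$, $+$, $\|$). Axioms with concrete action names stand for all instances with actions from $\mathcal{A}$. $\mathcal{E}_1$: A0 $x+\mathbf{0}\approx x$; A1 $x+y\approx y+x$; A2 $(x+y)+z \approx x+(y+z)$; A3 $x+x\approx x$; P0 $x\|\mathbf{0}\approx x$; P1 $x\|y \approx y \| x$. CT: $a(bx+z)+a(cy+w)\approx a(bx+cy+z+w)$. CTP: $(ax+by+w)\|z\approx(ax+w)\|z+(by+w)\|z$. T: $ax+ay\approx a(x+y)$. TP: $(x+y)\|z\approx x\|z+y\|z$. EL1: $ax\|by\approx a(x\|by)+b(ax\|y)$. *)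

theory Defs
  imports Main "HOL-Library.Countable" "HOL-Library.Infinite_Typeclass"
begin

text \<open>Terms of BCCSP with interleaving parallel composition. The action set is the type
  \<open>'a\<close> and the set of variables is the type \<open>'v\<close>; their cardinality conditions
  (finite, and countably infinite) are sort constraints, imposed where results are stated.\<close>

datatype ('a, vars: 'v) trm =
    Null  ("\<^bold>0")
  | Var 'v
  | Prefix 'a "('a, 'v) trm"  (infixr "\<^bold>." 80)
  | Plus "('a, 'v) trm" "('a, 'v) trm"  (infixl "\<^bold>+" 65)
  | Par "('a, 'v) trm" "('a, 'v) trm"  (infixl "\<^bold>\<parallel>" 70)

definition closed_term :: "('a, 'v) trm \<Rightarrow> bool" where
  "closed_term t \<longleftrightarrow> vars t = {}"

primrec subst :: "('v \<Rightarrow> ('a, 'v) trm) \<Rightarrow> ('a, 'v) trm \<Rightarrow> ('a, 'v) trm" where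
  "subst \<sigma> \<^bold>0 = \<^bold>0"
| "subst \<sigma> (Var x) = \<sigma> x"
| "subst \<sigma> (a \<^bold>. t) = a \<^bold>. subst \<sigma> t"
| "subst \<sigma> (t \<^bold>+ u) = subst \<sigma> t \<^bold>+ subst \<sigma> u"
| "subst \<sigma> (t \<^bold>\<parallel> u) = subst \<sigma> t \<^bold>\<parallel> subst \<sigma> u"


text \<open>The transition relation and the notions built on it are total on terms, variables having no
  transitions; they have their intended meaning on closed terms, whose derivatives are again closed.\<close>

inductive step :: "('a, 'v) trm \<Rightarrow> 'a \<Rightarrow> ('a, 'v) trm \<Rightarrow> bool" where
  prefix: "step (a \<^bold>. p) a p"
| plus_l: "step p a p' \<Longrightarrow> step (p \<^bold>+ q) a p'"
| plus_r: "step p a p' \<Longrightarrow> step (q \<^bold>+ p) a p'"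
| par_l: "step p a p' \<Longrightarrow> step (p \<^bold>\<parallel> q) a (p' \<^bold>\<parallel> q)"
| par_r: "step p a p' \<Longrightarrow> step (q \<^bold>\<parallel> p) a (q \<^bold>\<parallel> p')"

primrec steps :: "('a, 'v) trm \<Rightarrow> 'a list \<Rightarrow> ('a, 'v) trm \<Rightarrow> bool" where
  "steps p [] p' \<longleftrightarrow> p' = p"
| "steps p (a # \<alpha>) p' \<longleftrightarrow> (\<exists>r. step p a r \<and> steps r \<alpha> p')"

definition traces :: "('a, 'v) trm \<Rightarrow> 'a list set" where
  "traces p = {\<alpha>. \<exists>p'. steps p \<alpha> p'}"

definition completed_traces :: "('a, 'v) trm \<Rightarrow> 'a list set" where
  "completed_traces p = {\<alpha>. \<exists>p'. steps p \<alpha> p' \<and> (\<nexists>a p''. step p' a p'')}"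

datatype semantics = Sem_CT | Sem_T

primrec equivalent :: "semantics \<Rightarrow> ('a, 'v) trm \<Rightarrow> ('a, 'v) trm \<Rightarrow> bool" where
  "equivalent Sem_CT p q \<longleftrightarrow>
     traces p = traces q \<and> completed_traces p = completed_traces q"
| "equivalent Sem_T p q \<longleftrightarrow> traces p = traces q"


text \<open>An equation \<open>t \<approx> u\<close> is the pair \<open>(t, u)\<close>.\<close>

inductive derivable ::
  "(('a, 'v) trm \<times> ('a, 'v) trm) set \<Rightarrow> ('a, 'v) trm \<Rightarrow> ('a, 'v) trm \<Rightarrow> bool"
  ("_ \<turnstile> _ \<approx> _" [50, 51, 51] 50)
  for E where
  refl: "E \<turnstile> t \<approx> t"
| sym: "E \<turnstile> t \<approx> u \<Longrightarrow> E \<turnstile> u \<approx> t"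
| trans: "E \<turnstile> t \<approx> u \<Longrightarrow> E \<turnstile> u \<approx> v \<Longrightarrow> E \<turnstile> t \<approx> v"
| ax: "(t, u) \<in> E \<Longrightarrow> E \<turnstile> subst \<sigma> t \<approx> subst \<sigma> u"
| cong_prefix: "E \<turnstile> t \<approx> u \<Longrightarrow> E \<turnstile> a \<^bold>. t \<approx> a \<^bold>. u"
| cong_plus: "E \<turnstile> t \<approx> u \<Longrightarrow> E \<turnstile> t' \<approx> u' \<Longrightarrow> E \<turnstile> t \<^bold>+ t' \<approx> u \<^bold>+ u'"
| cong_par: "E \<turnstile> t \<approx> u \<Longrightarrow> E \<turnstile> t' \<approx> u' \<Longrightarrow> E \<turnstile> t \<^bold>\<parallel> t' \<approx> u \<^bold>\<parallel> u'"


text \<open>Since \<open>'v\<close> has no distinguished elements, each axiom is included for every choice of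
  pairwise distinct names for its variables; action names range over all actions and
  may coincide.\<close>

definition ax_A0 :: "(('a, 'v) trm \<times> ('a, 'v) trm) set" where
  "ax_A0 = {(Var x \<^bold>+ \<^bold>0, Var x) | x. True}"

definition ax_A1 :: "(('a, 'v) trm \<times> ('a, 'v) trm) set" where
  "ax_A1 = {(Var x \<^bold>+ Var y, Var y \<^bold>+ Var x) | x y. distinct [x, y]}"

definition ax_A2 :: "(('a, 'v) trm \<times> ('a, 'v) trm) set" where
  "ax_A2 = {((Var x \<^bold>+ Var y) \<^bold>+ Var z, Var x \<^bold>+ (Var y \<^bold>+ Var z)) | x y z. distinct [x, y, z]}"

definition ax_A3 :: "(('a, 'v) trm \<times> ('a, 'v) trm) set" where
  "ax_A3 = {(Var x \<^bold>+ Var x, Var x) | x. True}"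

definition ax_P0 :: "(('a, 'v) trm \<times> ('a, 'v) trm) set" where
  "ax_P0 = {(Var x \<^bold>\<parallel> \<^bold>0, Var x) | x. True}"

definition ax_P1 :: "(('a, 'v) trm \<times> ('a, 'v) trm) set" where
  "ax_P1 = {(Var x \<^bold>\<parallel> Var y, Var y \<^bold>\<parallel> Var x) | x y. distinct [x, y]}"

definition E1 :: "(('a, 'v) trm \<times> ('a, 'v) trm) set" where
  "E1 = ax_A0 \<union> ax_A1 \<union> ax_A2 \<union> ax_A3 \<union> ax_P0 \<union> ax_P1"

definition ax_CT :: "(('a, 'v) trm \<times> ('a, 'v) trm) set" where
  "ax_CT = {(a \<^bold>. (b \<^bold>. Var x \<^bold>+ Var z) \<^bold>+ a \<^bold>. (c \<^bold>. Var y \<^bold>+ Var w),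
             a \<^bold>. (b \<^bold>. Var x \<^bold>+ c \<^bold>. Var y \<^bold>+ Var z \<^bold>+ Var w))
            | a b c x y z w. distinct [x, y, z, w]}"

definition ax_CTP :: "(('a, 'v) trm \<times> ('a, 'v) trm) set" where
  "ax_CTP = {((a \<^bold>. Var x \<^bold>+ b \<^bold>. Var y \<^bold>+ Var w) \<^bold>\<parallel> Var z,
              (a \<^bold>. Var x \<^bold>+ Var w) \<^bold>\<parallel> Var z \<^bold>+ (b \<^bold>. Var y \<^bold>+ Var w) \<^bold>\<parallel> Var z)
             | a b x y z w. distinct [x, y, z, w]}"

definition ax_T :: "(('a, 'v) trm \<times> ('a, 'v) trm) set" where
  "ax_T = {(a \<^bold>. Var x \<^bold>+ a \<^bold>. Var y, a \<^bold>. (Var x \<^bold>+ Var y)) | a x y. distinct [x, y]}"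

definition ax_TP :: "(('a, 'v) trm \<times> ('a, 'v) trm) set" where
  "ax_TP = {((Var x \<^bold>+ Var y) \<^bold>\<parallel> Var z, Var x \<^bold>\<parallel> Var z \<^bold>+ Var y \<^bold>\<parallel> Var z)
            | x y z. distinct [x, y, z]}"

definition ax_EL1 :: "(('a, 'v) trm \<times> ('a, 'v) trm) set" where
  "ax_EL1 = {(a \<^bold>. Var x \<^bold>\<parallel> b \<^bold>. Var y,
              a \<^bold>. (Var x \<^bold>\<parallel> b \<^bold>. Var y) \<^bold>+ b \<^bold>. (a \<^bold>. Var x \<^bold>\<parallel> Var y))
             | a b x y. distinct [x, y]}"

primrec axioms_for :: "semantics \<Rightarrow> (('a, 'v) trm \<times> ('a, 'v) trm) set" where
  "axioms_for Sem_CT = E1 \<union> ax_CT \<union> ax_CTP \<union> ax_EL1"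
| "axioms_for Sem_T = E1 \<union> ax_T \<union> ax_TP \<union> ax_EL1"

definition ground_complete_axiomatisation ::
  "(('a, 'v) trm \<times> ('a, 'v) trm) set \<Rightarrow> (('a, 'v) trm \<Rightarrow> ('a, 'v) trm \<Rightarrow> bool) \<Rightarrow> bool" where
  "ground_complete_axiomatisation E R \<longleftrightarrow>
     (\<forall>p q. closed_term p \<longrightarrow> closed_term q \<longrightarrow> (R p q \<longleftrightarrow> E \<turnstile> p \<approx> q))"

end

theory Submission
  imports Defs
begin

text \<open>Soundness: traces and completed traces can be computed compositionally, with \<open>\<parallel>\<close> acting as
  shuffling, and each axiom becomes an identity between sets of words.  Completeness: CT (or T)
  distributes a prefix over a sum of prefixed terms, CTP (or TP) distributes \<open>\<parallel>\<close> over such a sum,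
  and EL1 expands two parallel words; hence every closed term is provably a sum of words.  Words
  of a CT normal form are its completed traces, so that equivalent normal forms have the same
  summands; for T, every trace of a normal form is a prefix of a summand and can be absorbed.\<close>

section \<open>Compositional trace semantics\<close>

inductive_cases step_prefixE: "step (a \<^bold>. p) b r"
inductive_cases step_NullE: "step \<^bold>0 b r"
inductive_cases step_VarE: "step (Var x) b r"
inductive_cases step_plusE: "step (p \<^bold>+ q) b r"
inductive_cases step_parE: "step (p \<^bold>\<parallel> q) b r"

lemma step_simps [simp]:
  "\<not> step \<^bold>0 b r"
  "\<not> step (Var x) b r"
  "step (a \<^bold>. p) b r \<longleftrightarrow> b = a \<and> r = p"
  "step (p \<^bold>+ q) b r \<longleftrightarrow> step p b r \<or> step q b r"
  "step (p \<^bold>\<parallel> q) b r \<longleftrightarrow>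
    (\<exists>p'. step p b p' \<and> r = p' \<^bold>\<parallel> q) \<or> (\<exists>q'. step q b q' \<and> r = p \<^bold>\<parallel> q')"
  by (auto elim: step_prefixE step_NullE step_VarE step_plusE step_parE intro: step.intros)

text \<open>The predicate \<open>P\<close> is a parameter so that one induction serves two purposes:
  the constantly true \<open>P\<close> yields traces, and being stuck yields completed traces. The
  recursion of \<open>shuffles\<close> records which component performs the first letter.\<close>

lemma steps_par:
  assumes P_par: "\<And>p q. P (p \<^bold>\<parallel> q) \<longleftrightarrow> P p \<and> P q"
  shows "(\<exists>r. steps (p \<^bold>\<parallel> q) \<alpha> r \<and> P r) \<longleftrightarrow>
    (\<exists>\<beta> \<gamma>. \<alpha> \<in> shuffles \<beta> \<gamma> \<and> (\<exists>p'. steps p \<beta> p' \<and> P p') \<and> (\<exists>q'. steps q \<gamma> q' \<and> P q'))"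
proof (induction \<alpha> arbitrary: p q)
  case Nil
  then show ?case by (simp add: P_par)
next
  case (Cons a \<alpha>)
  have "(\<exists>r. steps (p \<^bold>\<parallel> q) (a # \<alpha>) r \<and> P r) \<longleftrightarrow>
      (\<exists>p'. step p a p' \<and> (\<exists>r. steps (p' \<^bold>\<parallel> q) \<alpha> r \<and> P r)) \<or>
      (\<exists>q'. step q a q' \<and> (\<exists>r. steps (p \<^bold>\<parallel> q') \<alpha> r \<and> P r))"
    by auto
  also have "\<dots> \<longleftrightarrow> (\<exists>\<beta> \<gamma>. a # \<alpha> \<in> shuffles \<beta> \<gamma> \<and>
      (\<exists>p'. steps p \<beta> p' \<and> P p') \<and> (\<exists>q'. steps q \<gamma> q' \<and> P q'))" (is "?L \<longleftrightarrow> ?R")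
  proof
    assume ?L
    then show ?R
    proof (elim disjE exE conjE)
      fix p' r assume "step p a p'" "steps (p' \<^bold>\<parallel> q) \<alpha> r" "P r"
      moreover from this obtain \<beta> \<gamma> where "\<alpha> \<in> shuffles \<beta> \<gamma>"
        "\<exists>p''. steps p' \<beta> p'' \<and> P p''" "\<exists>q'. steps q \<gamma> q' \<and> P q'"
        using Cons.IH by blast
      ultimately show ?R
        by (intro exI[of _ "a # \<beta>"] exI[of _ \<gamma>]) (auto simp: Cons_in_shuffles_iff)
    next
      fix q' r assume "step q a q'" "steps (p \<^bold>\<parallel> q') \<alpha> r" "P r"
      moreover from this obtain \<beta> \<gamma> where "\<alpha> \<in> shuffles \<beta> \<gamma>"
        "\<exists>p''. steps p \<beta> p'' \<and> P p''" "\<exists>q''. steps q' \<gamma> q'' \<and> P q''"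
        using Cons.IH by blast
      ultimately show ?R
        by (intro exI[of _ \<beta>] exI[of _ "a # \<gamma>"]) (auto simp: Cons_in_shuffles_iff)
    qed
  next
    assume ?R
    then obtain \<beta> \<gamma> p' q' where *: "a # \<alpha> \<in> shuffles \<beta> \<gamma>"
      "steps p \<beta> p'" "P p'" "steps q \<gamma> q'" "P q'"
      by blast
    from *(1) consider \<beta>' where "\<beta> = a # \<beta>'" "\<alpha> \<in> shuffles \<beta>' \<gamma>"
      | \<gamma>' where "\<gamma> = a # \<gamma>'" "\<alpha> \<in> shuffles \<beta> \<gamma>'"
      by (cases \<beta>; cases \<gamma>) (auto simp: Cons_in_shuffles_iff)
    then show ?L
    proof cases
      case 1
      with *(2) obtain r where "step p a r" "steps r \<beta>' p'" by auto
      with 1 * Cons.IH[of r q] show ?thesis by blast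
    next
      case 2
      with *(4) obtain r where "step q a r" "steps r \<gamma>' q'" by auto
      with 2 * Cons.IH[of p r] show ?thesis by blast
    qed
  qed
  finally show ?case .
qed

lemma in_traces [simp]:
  "[] \<in> traces p"
  "a # \<alpha> \<in> traces p \<longleftrightarrow> (\<exists>r. step p a r \<and> \<alpha> \<in> traces r)"
  unfolding traces_def mem_Collect_eq steps.simps by blast+

lemma in_completed_traces [simp]:
  "[] \<in> completed_traces p \<longleftrightarrow> (\<nexists>a r. step p a r)"
  "a # \<alpha> \<in> completed_traces p \<longleftrightarrow> (\<exists>r. step p a r \<and> \<alpha> \<in> completed_traces r)"
  unfolding completed_traces_def mem_Collect_eq steps.simps by blast+

text \<open>The split into the empty word and a first letter fits \<open>in_traces\<close> and
  \<open>in_completed_traces\<close>, so the equations for prefix and sum follow from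
  \<open>step_simps\<close> without induction.\<close>

lemma word_set_eqI:
  assumes "[] \<in> A \<longleftrightarrow> [] \<in> B" "\<And>a \<alpha>. a # \<alpha> \<in> A \<longleftrightarrow> a # \<alpha> \<in> B"
  shows "A = B"
  using assms by (intro set_eqI) (metis list.exhaust)

lemma traces_simps [simp]:
  "traces \<^bold>0 = {[]}"
  "traces (Var x) = {[]}"
  "traces (a \<^bold>. p) = insert [] ((#) a ` traces p)"
  "traces (p \<^bold>+ q) = traces p \<union> traces q"
  by (rule word_set_eqI; auto)+

lemma traces_par [simp]:
  "traces (p \<^bold>\<parallel> q) = (\<Union>\<beta>\<in>traces p. \<Union>\<gamma>\<in>traces q. shuffles \<beta> \<gamma>)"
  using steps_par[of "\<lambda>_. True" p q] by (auto simp: traces_def set_eq_iff)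

text \<open>The empty word needs special treatment: a sum is stuck only if both summands are.\<close>

lemma completed_traces_simps [simp]:
  "completed_traces \<^bold>0 = {[]}"
  "completed_traces (Var x) = {[]}"
  "completed_traces (a \<^bold>. p) = (#) a ` completed_traces p"
  "completed_traces (p \<^bold>+ q) =
    (completed_traces p - {[]}) \<union> (completed_traces q - {[]}) \<union>
    (completed_traces p \<inter> completed_traces q \<inter> {[]})"
  by (rule word_set_eqI; auto)+

lemma completed_traces_par [simp]:
  fixes p q :: "('a, 'v) trm"
  shows "completed_traces (p \<^bold>\<parallel> q) =
    (\<Union>\<beta>\<in>completed_traces p. \<Union>\<gamma>\<in>completed_traces q. shuffles \<beta> \<gamma>)"
proof -
  \<comment> \<open>Stuckness of a parallel composition means stuckness of both components, which is
    the assumption of \<open>steps_par\<close>.\<close>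
  define stuck :: "('a, 'v) trm \<Rightarrow> bool" where "stuck t \<longleftrightarrow> (\<nexists>a r. step t a r)" for t
  have "stuck (t \<^bold>\<parallel> u) \<longleftrightarrow> stuck t \<and> stuck u" for t u
    by (auto simp: stuck_def)
  from steps_par[of stuck, OF this, of p q] show ?thesis
    unfolding completed_traces_def stuck_def[symmetric] by (auto simp: set_eq_iff)
qed

text \<open>Both sets are determined by the outgoing transitions alone.\<close>

lemma same_steps_same_traces:
  assumes "\<And>a r. step p a r \<longleftrightarrow> step q a r"
  shows "traces p = traces q" "completed_traces p = completed_traces q"
  by (rule word_set_eqI; simp add: assms)+

section \<open>Soundness\<close>

lemma shuffle_sets_commute:
  "(\<Union>\<beta>\<in>B. \<Union>\<gamma>\<in>C. shuffles \<beta> \<gamma>) = (\<Union>\<gamma>\<in>C. \<Union>\<beta>\<in>B. shuffles \<gamma> \<beta>)"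
  by (auto; metis shuffles_commutes)

text \<open>The explicit prefixes prevent every sum involved from being stuck, so the special case
  of the empty word vanishes and shuffling distributes over plain unions. TP fails here: for x = 0
  and y = z = a.0 only its right side has the completed trace a.\<close>

lemma completed_traces_CTP:
  "completed_traces ((a \<^bold>. p \<^bold>+ b \<^bold>. q \<^bold>+ r) \<^bold>\<parallel> s) =
    completed_traces ((a \<^bold>. p \<^bold>+ r) \<^bold>\<parallel> s \<^bold>+ (b \<^bold>. q \<^bold>+ r) \<^bold>\<parallel> s)"
proof -
  have sum: "completed_traces (a \<^bold>. p \<^bold>+ b \<^bold>. q \<^bold>+ r) =
      completed_traces (a \<^bold>. p \<^bold>+ r) \<union> completed_traces (b \<^bold>. q \<^bold>+ r)"
    by auto
  have "[] \<notin> completed_traces ((a \<^bold>. p \<^bold>+ r) \<^bold>\<parallel> s)" "[] \<notin> completed_traces ((b \<^bold>. q \<^bold>+ r) \<^bold>\<parallel> s)"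
    unfolding in_completed_traces by auto
  then have "completed_traces ((a \<^bold>. p \<^bold>+ r) \<^bold>\<parallel> s \<^bold>+ (b \<^bold>. q \<^bold>+ r) \<^bold>\<parallel> s) =
      completed_traces ((a \<^bold>. p \<^bold>+ r) \<^bold>\<parallel> s) \<union> completed_traces ((b \<^bold>. q \<^bold>+ r) \<^bold>\<parallel> s)"
    unfolding completed_traces_simps(4)[of "_ \<^bold>\<parallel> _"] by blast
  then show ?thesis unfolding completed_traces_par sum UN_Un by blast
qed

lemma axioms_sound:
  assumes "(t, u) \<in> axioms_for X"
  shows "equivalent X (subst \<sigma> t) (subst \<sigma> u)"
proof -
  \<comment> \<open>In these axioms both sides have literally the same derivatives. P0 and P1 change
    the derivatives and are settled by shuffles.\<close>
  let ?same_steps = "ax_A0 \<union> ax_A1 \<union> ax_A2 \<union> ax_A3 \<union> ax_EL1"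
  consider "(t, u) \<in> ?same_steps" | "(t, u) \<in> ax_P0 \<union> ax_P1"
    | "X = Sem_CT" "(t, u) \<in> ax_CT \<union> ax_CTP" | "X = Sem_T" "(t, u) \<in> ax_T \<union> ax_TP"
    using assms by (cases X) (auto simp: E1_def)
  then show ?thesis
  proof cases
    case 1
    then have "step (subst \<sigma> t) a r \<longleftrightarrow> step (subst \<sigma> u) a r" for a r
      by (auto simp: ax_A0_def ax_A1_def ax_A2_def ax_A3_def ax_EL1_def)
    from same_steps_same_traces[OF this] show ?thesis by (cases X) auto
  next
    case 2
    then show ?thesis
      by (cases X) (auto simp: ax_P0_def ax_P1_def shuffle_sets_commute)
  next
    case 3
    then show ?thesis
      \<comment> \<open>With \<open>completed_traces_par\<close> removed, the CTP terms keep the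
        shape to which \<open>completed_traces_CTP\<close> applies.\<close>
      by (auto simp: ax_CT_def ax_CTP_def completed_traces_CTP simp del: completed_traces_par)
  next
    case 4
    then show ?thesis by (auto simp: ax_T_def ax_TP_def)
  qed
qed

text \<open>The congruence rules are sound because the semantics of a compound term is a function of
  the semantics of its parts.\<close>

lemma derivable_sound:
  "axioms_for X \<turnstile> t \<approx> u \<Longrightarrow> equivalent X t u"
proof (induction rule: derivable.induct)
  case (ax t u \<sigma>)
  then show ?case by (rule axioms_sound)
qed (cases X; simp)+

section \<open>Sums\<close>

locale basic_laws =
  fixes E :: "(('a, 'v::infinite) trm \<times> ('a, 'v) trm) set"
  assumes E1_subset: "E1 \<subseteq> E"

text \<open>The axioms exist only for pairwise distinct variable names; CT and CTP mention
  four.\<close>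

lemma four_distinct:
  obtains x y z w :: "'v::infinite" where "distinct [x, y, z, w]"
proof -
  obtain x :: 'v where True by blast
  obtain y where "y \<notin> {x}" using ex_new_if_finite[OF infinite_UNIV, of "{x}"] by auto
  moreover obtain z where "z \<notin> {x, y}" using ex_new_if_finite[OF infinite_UNIV, of "{x, y}"] by auto
  moreover obtain w where "w \<notin> {x, y, z}"
    using ex_new_if_finite[OF infinite_UNIV, of "{x, y, z}"] by auto
  ultimately have "distinct [x, y, z, w]" by auto
  then show thesis by (rule that)
qed

text \<open>The two equations let the simplifier evaluate a chosen substitution. In
  \<open>(\<lambda>_. t)(y := u)\<close> the default value \<open>t\<close> is what the variable
  \<open>x\<close> receives.\<close>

lemma ax_instance:
  assumes "(t, u) \<in> E" "subst \<sigma> t = t'" "subst \<sigma> u = u'"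
  shows "E \<turnstile> t' \<approx> u'"
  using ax[OF assms(1), of \<sigma>] assms(2,3) by simp

declare derivable.trans [trans]

context basic_laws
begin

lemma A0: "E \<turnstile> t \<^bold>+ \<^bold>0 \<approx> t"
  by (rule ax_instance[of "Var undefined \<^bold>+ \<^bold>0" "Var undefined" _ "\<lambda>_. t"])
    (use E1_subset in \<open>auto simp: E1_def ax_A0_def\<close>)

lemma A3: "E \<turnstile> t \<^bold>+ t \<approx> t"
  by (rule ax_instance[of "Var undefined \<^bold>+ Var undefined" "Var undefined" _ "\<lambda>_. t"])
    (use E1_subset in \<open>auto simp: E1_def ax_A3_def\<close>)

lemma P0: "E \<turnstile> t \<^bold>\<parallel> \<^bold>0 \<approx> t"
  by (rule ax_instance[of "Var undefined \<^bold>\<parallel> \<^bold>0" "Var undefined" _ "\<lambda>_. t"])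
    (use E1_subset in \<open>auto simp: E1_def ax_P0_def\<close>)

lemma A1: "E \<turnstile> t \<^bold>+ u \<approx> u \<^bold>+ t"
proof -
  obtain x y z w :: 'v where "distinct [x, y, z, w]" by (rule four_distinct)
  with E1_subset show ?thesis
    by (intro ax_instance[of "Var x \<^bold>+ Var y" "Var y \<^bold>+ Var x" _ "(\<lambda>_. t)(y := u)"])
      (auto simp: E1_def ax_A1_def)
qed

lemma P1: "E \<turnstile> t \<^bold>\<parallel> u \<approx> u \<^bold>\<parallel> t"
proof -
  obtain x y z w :: 'v where "distinct [x, y, z, w]" by (rule four_distinct)
  with E1_subset show ?thesis
    by (intro ax_instance[of "Var x \<^bold>\<parallel> Var y" "Var y \<^bold>\<parallel> Var x" _ "(\<lambda>_. t)(y := u)"])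
      (auto simp: E1_def ax_P1_def)
qed

lemma A2: "E \<turnstile> (t \<^bold>+ u) \<^bold>+ v \<approx> t \<^bold>+ (u \<^bold>+ v)"
proof -
  obtain x y z w :: 'v where "distinct [x, y, z, w]" by (rule four_distinct)
  with E1_subset show ?thesis
    by (intro ax_instance[of "(Var x \<^bold>+ Var y) \<^bold>+ Var z" "Var x \<^bold>+ (Var y \<^bold>+ Var z)" _
          "(\<lambda>_. t)(y := u, z := v)"])
      (auto simp: E1_def ax_A2_def)
qed

end

section \<open>Absorption and sets of summands\<close>

primrec summands :: "('a, 'v) trm \<Rightarrow> ('a, 'v) trm set" where
  "summands \<^bold>0 = {}"
| "summands (Var x) = {Var x}"
| "summands (a \<^bold>. t) = {a \<^bold>. t}"
| "summands (t \<^bold>+ u) = summands t \<union> summands u"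
| "summands (t \<^bold>\<parallel> u) = {t \<^bold>\<parallel> u}"

context basic_laws
begin

text \<open>Derivability of s + t = t expresses s \<le> t in the semilattice given by A0 to A3. This
  lemma and the next ones are the order rules for joins and the least element.\<close>

lemma absorb_plus_left:
  assumes "E \<turnstile> s \<^bold>+ t \<approx> t"
  shows "E \<turnstile> s \<^bold>+ (t \<^bold>+ u) \<approx> t \<^bold>+ u"
  by (rule derivable.trans[OF derivable.sym[OF A2] cong_plus[OF assms refl]])

lemma absorb_plus_right:
  assumes "E \<turnstile> s \<^bold>+ u \<approx> u"
  shows "E \<turnstile> s \<^bold>+ (t \<^bold>+ u) \<approx> t \<^bold>+ u"
proof -
  have "E \<turnstile> s \<^bold>+ (t \<^bold>+ u) \<approx> s \<^bold>+ (u \<^bold>+ t)" by (intro cong_plus refl A1)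
  also have "E \<turnstile> \<dots> \<approx> u \<^bold>+ t" by (intro absorb_plus_left assms)
  also have "E \<turnstile> \<dots> \<approx> t \<^bold>+ u" by (rule A1)
  finally show ?thesis .
qed

lemma absorb_summand: "s \<in> summands t \<Longrightarrow> E \<turnstile> s \<^bold>+ t \<approx> t"
  by (induction t) (auto intro: A3 absorb_plus_left absorb_plus_right)

lemma absorb_sum:
  assumes "E \<turnstile> s \<^bold>+ u \<approx> u" "E \<turnstile> t \<^bold>+ u \<approx> u"
  shows "E \<turnstile> (s \<^bold>+ t) \<^bold>+ u \<approx> u"
proof -
  have "E \<turnstile> (s \<^bold>+ t) \<^bold>+ u \<approx> s \<^bold>+ (t \<^bold>+ u)" by (rule A2)
  also have "E \<turnstile> \<dots> \<approx> s \<^bold>+ u" by (intro cong_plus refl assms)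
  also note assms(1)
  finally show ?thesis .
qed

lemma absorb_Null: "E \<turnstile> \<^bold>0 \<^bold>+ t \<approx> t"
  by (rule derivable.trans[OF A1 A0])

lemma absorb_summands: "summands t \<subseteq> summands u \<Longrightarrow> E \<turnstile> t \<^bold>+ u \<approx> u"
  by (induction t) (auto intro: absorb_summand absorb_sum absorb_Null)

text \<open>Antisymmetry of the absorption order.\<close>

lemma mutual_absorption:
  assumes "E \<turnstile> t \<^bold>+ u \<approx> u" "E \<turnstile> u \<^bold>+ t \<approx> t"
  shows "E \<turnstile> t \<approx> u"
proof -
  have "E \<turnstile> t \<approx> u \<^bold>+ t" by (rule derivable.sym[OF assms(2)])
  also have "E \<turnstile> \<dots> \<approx> t \<^bold>+ u" by (rule A1)
  also note assms(1)
  finally show ?thesis .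
qed

text \<open>Reasoning modulo A0 to A3 thereby becomes an equation between sets; it settles all later
  rearrangements of sums.\<close>

lemma same_summands: "summands t = summands u \<Longrightarrow> E \<turnstile> t \<approx> u"
  by (rule mutual_absorption; simp add: absorb_summands)

end

section \<open>Reduction to sums of words\<close>

primrec word :: "'a list \<Rightarrow> ('a, 'v) trm" where
  "word [] = \<^bold>0"
| "word (a # \<alpha>) = a \<^bold>. word \<alpha>"

primrec word_sum :: "'a list list \<Rightarrow> ('a, 'v) trm" where
  "word_sum [] = \<^bold>0"
| "word_sum (\<alpha> # A) = word \<alpha> \<^bold>+ word_sum A"

lemma summands_word: "summands (word \<alpha>) = (if \<alpha> = [] then {} else {word \<alpha>})"
  by (cases \<alpha>) auto

lemma summands_word_sum: "summands (word_sum A) = word ` (set A - {[]})"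
  by (induction A) (auto simp: summands_word)

lemma traces_word: "\<beta> \<in> traces (word \<alpha>) \<longleftrightarrow> (\<exists>\<gamma>. \<alpha> = \<beta> @ \<gamma>)"
  by (induction \<alpha> arbitrary: \<beta>) (auto simp: Cons_eq_append_conv)

lemma traces_word_sum:
  "traces (word_sum A :: ('a, 'v) trm) =
    insert [] (\<Union>\<alpha>\<in>set A. traces (word \<alpha> :: ('a, 'v) trm))"
  by (induction A) auto

lemma completed_traces_word: "completed_traces (word \<alpha>) = {\<alpha>}"
  by (induction \<alpha>) auto

text \<open>The empty word must be set aside: it stands for the summand 0, invisible beside a
  nonempty word, while the empty sum has the empty completed trace without listing it.\<close>

lemma completed_traces_word_sum: "completed_traces (word_sum A) - {[]} = set A - {[]}"
  by (induction A) (auto simp: completed_traces_word)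

text \<open>The distributive laws have the form of CT and CTP, which T and TP also imply; so both
  axiom systems are treated at once.\<close>

locale elimination_laws = basic_laws E
  for E :: "(('a, 'v::infinite) trm \<times> ('a, 'v) trm) set" +
  assumes prefix_distrib: "E \<turnstile> a \<^bold>. (b \<^bold>. t \<^bold>+ (c \<^bold>. u \<^bold>+ v)) \<approx> a \<^bold>. b \<^bold>. t \<^bold>+ a \<^bold>. (c \<^bold>. u \<^bold>+ v)"
    and par_distrib: "E \<turnstile> (a \<^bold>. t \<^bold>+ b \<^bold>. u \<^bold>+ v) \<^bold>\<parallel> s \<approx> (a \<^bold>. t \<^bold>+ v) \<^bold>\<parallel> s \<^bold>+ (b \<^bold>. u \<^bold>+ v) \<^bold>\<parallel> s"
    and EL1: "E \<turnstile> a \<^bold>. t \<^bold>\<parallel> b \<^bold>. u \<approx> a \<^bold>. (t \<^bold>\<parallel> b \<^bold>. u) \<^bold>+ b \<^bold>. (a \<^bold>. t \<^bold>\<parallel> u)"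
begin

text \<open>Excluding the empty word makes each summand start with an action, as
  \<open>prefix_distrib\<close> and \<open>par_distrib\<close> demand.\<close>

definition reducible :: "('a, 'v) trm \<Rightarrow> bool" where
  "reducible t \<longleftrightarrow> (\<exists>A. [] \<notin> set A \<and> E \<turnstile> t \<approx> word_sum A)"

lemma reducible_cong: "reducible u \<Longrightarrow> E \<turnstile> t \<approx> u \<Longrightarrow> reducible t"
  unfolding reducible_def by (blast intro: derivable.trans)

lemma reducible_word_sum: "reducible (word_sum A)"
  unfolding reducible_def
  by (intro exI[of _ "filter (\<lambda>\<alpha>. \<alpha> \<noteq> []) A"] conjI same_summands) (auto simp: summands_word_sum)

lemma reducible_plus:
  assumes "reducible t" "reducible u"
  shows "reducible (t \<^bold>+ u)"
proof -
  obtain A B where AB: "E \<turnstile> t \<approx> word_sum A" "E \<turnstile> u \<approx> word_sum B"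
    using assms by (auto simp: reducible_def)
  have "E \<turnstile> t \<^bold>+ u \<approx> word_sum A \<^bold>+ word_sum B" by (intro cong_plus AB)
  also have "E \<turnstile> \<dots> \<approx> word_sum (A @ B)"
    by (intro same_summands) (auto simp: summands_word_sum)
  finally show ?thesis by (rule reducible_cong[OF reducible_word_sum])
qed

lemma reducible_word: "reducible (word \<alpha>)"
  by (rule reducible_cong[OF reducible_word_sum[of "[\<alpha>]"]])
    (auto intro: same_summands)

text \<open>\<open>prefix_distrib\<close> splits off one summand but needs a second prefixed one, so
  lists of length zero and one are base cases; there the term is a single word up to A0.\<close>

lemma reducible_prefix_word_sum: "[] \<notin> set A \<Longrightarrow> reducible (a \<^bold>. word_sum A)"
proof (induction A rule: induct_list012)
  case 1
  then show ?case using reducible_word[of "[a]"] by simp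
next
  case (2 \<alpha>)
  show ?case
    by (rule reducible_cong[OF reducible_word[of "a # \<alpha>"]]) (auto intro: cong_prefix A0)
next
  case (3 \<alpha> \<beta> A)
  then obtain b \<alpha>' c \<beta>' where *: "\<alpha> = b # \<alpha>'" "\<beta> = c # \<beta>'"
    by (cases \<alpha>; cases \<beta>) auto
  have "E \<turnstile> a \<^bold>. word_sum (\<alpha> # \<beta> # A) \<approx> a \<^bold>. word \<alpha> \<^bold>+ a \<^bold>. word_sum (\<beta> # A)"
    unfolding * by (simp add: prefix_distrib)
  moreover have "reducible \<dots>"
    using 3 reducible_word[of "a # \<alpha>"] by (intro reducible_plus) auto
  ultimately show ?case by (rule reducible_cong[rotated])
qed

lemma reducible_prefix:
  assumes "reducible t"
  shows "reducible (a \<^bold>. t)"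
proof -
  obtain A where "[] \<notin> set A" "E \<turnstile> t \<approx> word_sum A"
    using assms by (auto simp: reducible_def)
  then show ?thesis
    by (blast intro: reducible_cong[OF reducible_prefix_word_sum] cong_prefix)
qed

text \<open>EL1 mirrors the recursion of \<open>shuffles\<close>: each resulting parallel
  composition has lost one letter of one word.\<close>

lemma reducible_par_words: "reducible (word \<alpha> \<^bold>\<parallel> word \<beta>)"
proof (induction \<alpha> \<beta> rule: shuffles.induct)
  case (1 \<beta>)
  show ?case
    by (rule reducible_cong[OF reducible_word[of \<beta>]]) (simp add: derivable.trans[OF P1 P0])
next
  case (2 \<alpha>)
  show ?case
    by (rule reducible_cong[OF reducible_word[of \<alpha>]]) (auto intro: P0)
next
  case (3 a \<alpha> b \<beta>)
  then have "reducible (a \<^bold>. (word \<alpha> \<^bold>\<parallel> b \<^bold>. word \<beta>) \<^bold>+ b \<^bold>. (a \<^bold>. word \<alpha> \<^bold>\<parallel> word \<beta>))"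
    by (auto intro!: reducible_plus reducible_prefix)
  then show ?case by (simp add: reducible_cong[OF _ EL1])
qed

text \<open>Unlike TP, CTP only separates two of the summands and repeats the remaining ones, hence the
  induction on the number of summands.\<close>

lemma reducible_word_sum_par:
  assumes "\<forall>\<alpha>\<in>set A. reducible (word \<alpha> \<^bold>\<parallel> s)" "[] \<notin> set A" "reducible s"
  shows "reducible (word_sum A \<^bold>\<parallel> s)"
  using assms
proof (induction "length A" arbitrary: A rule: less_induct)
  case less
  consider "A = []" | \<alpha> where "A = [\<alpha>]" | \<alpha> \<beta> B where "A = \<alpha> # \<beta> # B"
    by (metis list.exhaust)
  then show ?case
  proof cases
    case 1
    then show ?thesis
      using reducible_cong[OF less.prems(3) derivable.trans[OF P1 P0]] by simp
  next
    case 2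
    then have "reducible (word \<alpha> \<^bold>\<parallel> s)" using less.prems by simp
    then show ?thesis
      unfolding 2 by (rule reducible_cong) (simp add: cong_par A0 refl)
  next
    case 3
    with less.prems(2) have "\<alpha> \<noteq> []" "\<beta> \<noteq> []" by auto
    then obtain a \<alpha>' b \<beta>' where *: "\<alpha> = a # \<alpha>'" "\<beta> = b # \<beta>'"
      by (auto simp: neq_Nil_conv)
    \<comment> \<open>Regrouping to the left yields the shape of \<open>par_distrib\<close>; both
      resulting lists are one shorter than \<open>A\<close>.\<close>
    have "E \<turnstile> word_sum A \<^bold>\<parallel> s \<approx> (word \<alpha> \<^bold>+ word \<beta> \<^bold>+ word_sum B) \<^bold>\<parallel> s"
      unfolding 3 by (rule cong_par[OF same_summands refl]) auto
    also have "E \<turnstile> \<dots> \<approx> word_sum (\<alpha> # B) \<^bold>\<parallel> s \<^bold>+ word_sum (\<beta> # B) \<^bold>\<parallel> s"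
      unfolding * by (simp add: par_distrib)
    finally have "E \<turnstile> word_sum A \<^bold>\<parallel> s \<approx> word_sum (\<alpha> # B) \<^bold>\<parallel> s \<^bold>+ word_sum (\<beta> # B) \<^bold>\<parallel> s" .
    moreover have "reducible (word_sum (\<alpha> # B) \<^bold>\<parallel> s)" "reducible (word_sum (\<beta> # B) \<^bold>\<parallel> s)"
      using less.hyps[of "\<alpha> # B"] less.hyps[of "\<beta> # B"] less.prems 3 by simp_all
    ultimately show ?thesis by (blast intro: reducible_cong reducible_plus)
  qed
qed

lemma reducible_par:
  assumes "reducible t" "reducible u"
  shows "reducible (t \<^bold>\<parallel> u)"
proof -
  obtain A B where A: "[] \<notin> set A" "E \<turnstile> t \<approx> word_sum A"
    and B: "[] \<notin> set B" "E \<turnstile> u \<approx> word_sum B"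
    using assms by (auto simp: reducible_def)
  \<comment> \<open>Distribution acts on the left argument only, so \<open>B\<close> is expanded
    first against a single word, then P1 swaps the sides and \<open>A\<close> is expanded.\<close>
  have "reducible (word_sum B \<^bold>\<parallel> word \<alpha>)" for \<alpha>
    by (intro reducible_word_sum_par ballI reducible_par_words B reducible_word)
  then have "reducible (word \<alpha> \<^bold>\<parallel> word_sum B)" for \<alpha>
    by (blast intro: reducible_cong P1)
  then have "reducible (word_sum A \<^bold>\<parallel> word_sum B)"
    by (intro reducible_word_sum_par ballI A reducible_word_sum)
  then show ?thesis
    by (rule reducible_cong) (intro cong_par A B)
qed

text \<open>All operators preserve reducibility; closedness rules out the variable case of the
  induction.\<close>

lemma closed_reducible: "closed_term t \<Longrightarrow> reducible t"
  unfolding closed_term_def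
  by (induction t)
    (use reducible_word_sum[of "[]"] in \<open>auto intro: reducible_prefix reducible_plus reducible_par\<close>)

end

section \<open>Completeness\<close>

lemma elimination_laws_CT:
  "elimination_laws (axioms_for Sem_CT :: (('a, 'v::infinite) trm \<times> ('a, 'v) trm) set)"
proof -
  let ?E = "axioms_for Sem_CT :: (('a, 'v) trm \<times> ('a, 'v) trm) set"
  interpret basic_laws ?E by standard auto
  obtain x y z w :: 'v where d: "distinct [x, y, z, w]" by (rule four_distinct)
  show ?thesis
  proof
    fix a b c :: 'a and t u v :: "('a, 'v) trm"
    \<comment> \<open>CT expects a remainder beside each prefixed summand; 0 is inserted as the
      remainder of the first and later removed by A0.\<close>
    have "?E \<turnstile> a \<^bold>. (b \<^bold>. t \<^bold>+ (c \<^bold>. u \<^bold>+ v)) \<approx> a \<^bold>. (b \<^bold>. t \<^bold>+ c \<^bold>. u \<^bold>+ \<^bold>0 \<^bold>+ v)"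
      by (intro cong_prefix same_summands) auto
    also have "?E \<turnstile> \<dots> \<approx> a \<^bold>. (b \<^bold>. t \<^bold>+ \<^bold>0) \<^bold>+ a \<^bold>. (c \<^bold>. u \<^bold>+ v)"
      by (rule derivable.sym, rule ax_instance[of
          "a \<^bold>. (b \<^bold>. Var x \<^bold>+ Var z) \<^bold>+ a \<^bold>. (c \<^bold>. Var y \<^bold>+ Var w)"
          "a \<^bold>. (b \<^bold>. Var x \<^bold>+ c \<^bold>. Var y \<^bold>+ Var z \<^bold>+ Var w)" _
          "(\<lambda>_. t)(y := u, z := \<^bold>0, w := v)"])
        (use d in \<open>auto simp: ax_CT_def\<close>)
    also have "?E \<turnstile> \<dots> \<approx> a \<^bold>. b \<^bold>. t \<^bold>+ a \<^bold>. (c \<^bold>. u \<^bold>+ v)"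
      by (intro cong_plus cong_prefix A0 refl)
    finally show "?E \<turnstile> a \<^bold>. (b \<^bold>. t \<^bold>+ (c \<^bold>. u \<^bold>+ v)) \<approx> a \<^bold>. b \<^bold>. t \<^bold>+ a \<^bold>. (c \<^bold>. u \<^bold>+ v)" .
  next
    fix a b :: 'a and t u v s :: "('a, 'v) trm"
    show "?E \<turnstile> (a \<^bold>. t \<^bold>+ b \<^bold>. u \<^bold>+ v) \<^bold>\<parallel> s \<approx> (a \<^bold>. t \<^bold>+ v) \<^bold>\<parallel> s \<^bold>+ (b \<^bold>. u \<^bold>+ v) \<^bold>\<parallel> s"
      by (rule ax_instance[of "(a \<^bold>. Var x \<^bold>+ b \<^bold>. Var y \<^bold>+ Var w) \<^bold>\<parallel> Var z"
          "(a \<^bold>. Var x \<^bold>+ Var w) \<^bold>\<parallel> Var z \<^bold>+ (b \<^bold>. Var y \<^bold>+ Var w) \<^bold>\<parallel> Var z" _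
          "(\<lambda>_. t)(y := u, w := v, z := s)"])
        (use d in \<open>auto simp: ax_CTP_def\<close>)
    show "?E \<turnstile> a \<^bold>. t \<^bold>\<parallel> b \<^bold>. u \<approx> a \<^bold>. (t \<^bold>\<parallel> b \<^bold>. u) \<^bold>+ b \<^bold>. (a \<^bold>. t \<^bold>\<parallel> u)"
      by (rule ax_instance[of "a \<^bold>. Var x \<^bold>\<parallel> b \<^bold>. Var y"
          "a \<^bold>. (Var x \<^bold>\<parallel> b \<^bold>. Var y) \<^bold>+ b \<^bold>. (a \<^bold>. Var x \<^bold>\<parallel> Var y)" _ "(\<lambda>_. t)(y := u)"])
        (use d in \<open>auto simp: ax_EL1_def\<close>)
  qed
qed

lemma prefix_plus_Sem_T:
  fixes t u :: "('a, 'v::infinite) trm"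
  shows "axioms_for Sem_T \<turnstile> a \<^bold>. t \<^bold>+ a \<^bold>. u \<approx> a \<^bold>. (t \<^bold>+ u)"
proof -
  obtain x y z w :: 'v where "distinct [x, y, z, w]" by (rule four_distinct)
  then show ?thesis
    by (intro ax_instance[of "a \<^bold>. Var x \<^bold>+ a \<^bold>. Var y" "a \<^bold>. (Var x \<^bold>+ Var y)" _
          "(\<lambda>_. t)(y := u)"])
      (auto simp: ax_T_def)
qed

lemma elimination_laws_T:
  "elimination_laws (axioms_for Sem_T :: (('a, 'v::infinite) trm \<times> ('a, 'v) trm) set)"
proof -
  let ?E = "axioms_for Sem_T :: (('a, 'v) trm \<times> ('a, 'v) trm) set"
  interpret basic_laws ?E by standard auto
  obtain x y z w :: 'v where d: "distinct [x, y, z, w]" by (rule four_distinct)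
  have TP: "?E \<turnstile> (t \<^bold>+ u) \<^bold>\<parallel> s \<approx> t \<^bold>\<parallel> s \<^bold>+ u \<^bold>\<parallel> s" for t u s
    by (rule ax_instance[of "(Var x \<^bold>+ Var y) \<^bold>\<parallel> Var z" "Var x \<^bold>\<parallel> Var z \<^bold>+ Var y \<^bold>\<parallel> Var z" _
          "(\<lambda>_. t)(y := u, z := s)"])
      (use d in \<open>auto simp: ax_TP_def\<close>)
  show ?thesis
  proof
    fix a b c :: 'a and t u v :: "('a, 'v) trm"
    show "?E \<turnstile> a \<^bold>. (b \<^bold>. t \<^bold>+ (c \<^bold>. u \<^bold>+ v)) \<approx> a \<^bold>. b \<^bold>. t \<^bold>+ a \<^bold>. (c \<^bold>. u \<^bold>+ v)"
      by (rule derivable.sym[OF prefix_plus_Sem_T])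
  next
    fix a b :: 'a and t u v s :: "('a, 'v) trm"
    have "?E \<turnstile> (a \<^bold>. t \<^bold>+ b \<^bold>. u \<^bold>+ v) \<^bold>\<parallel> s \<approx> (a \<^bold>. t \<^bold>\<parallel> s \<^bold>+ b \<^bold>. u \<^bold>\<parallel> s) \<^bold>+ v \<^bold>\<parallel> s"
      by (intro derivable.trans[OF TP] cong_plus TP refl)
    \<comment> \<open>Idempotence duplicates the summand \<open>v \<parallel> s\<close>, which TP
      produces once and the CTP form contains twice.\<close>
    also have "?E \<turnstile> \<dots> \<approx> (a \<^bold>. t \<^bold>\<parallel> s \<^bold>+ v \<^bold>\<parallel> s) \<^bold>+ (b \<^bold>. u \<^bold>\<parallel> s \<^bold>+ v \<^bold>\<parallel> s)"
      by (intro same_summands) auto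
    also have "?E \<turnstile> \<dots> \<approx> (a \<^bold>. t \<^bold>+ v) \<^bold>\<parallel> s \<^bold>+ (b \<^bold>. u \<^bold>+ v) \<^bold>\<parallel> s"
      by (intro cong_plus derivable.sym[OF TP])
    finally show "?E \<turnstile> (a \<^bold>. t \<^bold>+ b \<^bold>. u \<^bold>+ v) \<^bold>\<parallel> s \<approx> (a \<^bold>. t \<^bold>+ v) \<^bold>\<parallel> s \<^bold>+ (b \<^bold>. u \<^bold>+ v) \<^bold>\<parallel> s" .
    show "?E \<turnstile> a \<^bold>. t \<^bold>\<parallel> b \<^bold>. u \<approx> a \<^bold>. (t \<^bold>\<parallel> b \<^bold>. u) \<^bold>+ b \<^bold>. (a \<^bold>. t \<^bold>\<parallel> u)"
      by (rule ax_instance[of "a \<^bold>. Var x \<^bold>\<parallel> b \<^bold>. Var y"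
          "a \<^bold>. (Var x \<^bold>\<parallel> b \<^bold>. Var y) \<^bold>+ b \<^bold>. (a \<^bold>. Var x \<^bold>\<parallel> Var y)" _ "(\<lambda>_. t)(y := u)"])
        (use d in \<open>auto simp: ax_EL1_def\<close>)
  qed
qed

lemma elimination_laws_axioms_for:
  "elimination_laws (axioms_for X :: (('a, 'v::infinite) trm \<times> ('a, 'v) trm) set)"
  by (cases X) (use elimination_laws_CT elimination_laws_T in blast)+

section \<open>Equivalent sums of words are provably equal\<close>

text \<open>T merges equal first letters, and the induction hypothesis applies below the prefix.
  Modulo completed traces this is unsound when both words are nonempty, since \<open>\<beta>\<close>
  becomes an additional completed trace.\<close>

lemma absorb_prefix_word_Sem_T:
  "axioms_for Sem_T \<turnstile> word \<beta> \<^bold>+ word (\<beta> @ \<gamma>) \<approx> (word (\<beta> @ \<gamma>) :: ('a, 'v::infinite) trm)"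
proof -
  interpret elimination_laws "axioms_for Sem_T :: (('a, 'v) trm \<times> ('a, 'v) trm) set"
    by (rule elimination_laws_T)
  show ?thesis
  proof (induction \<beta>)
    case Nil
    \<comment> \<open>Keeping \<open>axioms_for\<close> folded lets the derivability facts
      match.\<close>
    show ?case by (simp add: absorb_Null del: axioms_for.simps)
  next
    case (Cons b \<beta>)
    then show ?case
      using derivable.trans[OF prefix_plus_Sem_T cong_prefix] by (simp del: axioms_for.simps)
  qed
qed

lemma absorb_trace_Sem_T:
  assumes "\<beta> \<in> traces (word_sum A :: ('a, 'v::infinite) trm)"
  shows "axioms_for Sem_T \<turnstile> word \<beta> \<^bold>+ word_sum A \<approx> (word_sum A :: ('a, 'v) trm)"
proof -
  interpret elimination_laws "axioms_for Sem_T :: (('a, 'v) trm \<times> ('a, 'v) trm) set"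
    by (rule elimination_laws_T)
  show ?thesis
  \<comment> \<open>The empty trace is separate because an empty \<open>A\<close> offers no word
    extending it.\<close>
  proof (cases "\<beta> = []")
    case True
    then show ?thesis by (simp add: absorb_Null del: axioms_for.simps)
  next
    case False
    then obtain \<gamma> where "\<beta> @ \<gamma> \<in> set A"
      using assms by (auto simp: traces_word_sum traces_word)
    then show ?thesis
      by (induction A) (auto intro: absorb_plus_left absorb_plus_right absorb_prefix_word_Sem_T
        simp del: axioms_for.simps)
  qed
qed

lemma absorb_traces_Sem_T:
  assumes "traces (word_sum A :: ('a, 'v::infinite) trm) \<subseteq> traces (word_sum B :: ('a, 'v) trm)"
  shows "axioms_for Sem_T \<turnstile> word_sum A \<^bold>+ word_sum B \<approx> (word_sum B :: ('a, 'v) trm)"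
proof -
  interpret elimination_laws "axioms_for Sem_T :: (('a, 'v) trm \<times> ('a, 'v) trm) set"
    by (rule elimination_laws_T)
  from assms show ?thesis
  proof (induction A)
    case Nil
    show ?case by (simp add: absorb_Null del: axioms_for.simps)
  next
    case (Cons \<alpha> A)
    \<comment> \<open>A word is one of its own traces, so the assumed inclusion makes it a trace of
      the sum over \<open>B\<close>.\<close>
    have "\<alpha> \<in> traces (word \<alpha> :: ('a, 'v) trm)" by (simp add: traces_word)
    with Cons show ?case
      by (auto intro!: absorb_sum absorb_trace_Sem_T simp del: axioms_for.simps)
  qed
qed

lemma word_sum_complete:
  fixes A B :: "'a list list"
  assumes "equivalent X (word_sum A :: ('a, 'v::infinite) trm) (word_sum B)"
  shows "axioms_for X \<turnstile> word_sum A \<approx> (word_sum B :: ('a, 'v) trm)"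
proof -
  interpret elimination_laws "axioms_for X :: (('a, 'v) trm \<times> ('a, 'v) trm) set"
    by (rule elimination_laws_axioms_for)
  show ?thesis
  proof (cases X)
    case Sem_CT
    then have "set A - {[]} = set B - {[]}"
      using assms completed_traces_word_sum[where 'b = 'v, of A]
        completed_traces_word_sum[where 'b = 'v, of B] by simp
    then show ?thesis by (intro same_summands) (simp add: summands_word_sum)
  next
    case Sem_T
    show ?thesis
      by (rule mutual_absorption)
        (use assms absorb_traces_Sem_T in \<open>auto simp: Sem_T simp del: axioms_for.simps\<close>)
  qed
qed

theorem theorem5p15:
  fixes X :: semantics
  shows "ground_complete_axiomatisation
    (axioms_for X :: (('a::finite, 'v::{countable, infinite}) trm \<times> ('a, 'v) trm) set)
    (equivalent X)"
proof -
  let ?E = "axioms_for X :: (('a, 'v) trm \<times> ('a, 'v) trm) set"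
  interpret elimination_laws ?E by (rule elimination_laws_axioms_for)
  have "?E \<turnstile> p \<approx> q" if closed: "closed_term p" "closed_term q" and pq: "equivalent X p q" for p q
  proof -
    obtain A B where A: "?E \<turnstile> p \<approx> word_sum A" and B: "?E \<turnstile> q \<approx> word_sum B"
      using closed[THEN closed_reducible] by (auto simp: reducible_def)
    \<comment> \<open>Soundness transfers the equivalence of \<open>p\<close> and \<open>q\<close>
      to their normal forms.\<close>
    have "equivalent X (word_sum A :: ('a, 'v) trm) (word_sum B)"
      using pq derivable_sound[OF A] derivable_sound[OF B] by (cases X) auto
    then have "?E \<turnstile> word_sum A \<approx> word_sum B" by (rule word_sum_complete)
    with A B show ?thesis by (blast intro: derivable.trans derivable.sym)
  qed
  then show ?thesis
    unfolding ground_complete_axiomatisation_def by (blast intro: derivable_sound)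
qed

end
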